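(* Let $\mathbb K$ be a field, $X$ a set, $F\subseteq\mathbb K\langle X\rangle$ a set of polynomials, $Q$ a labelled quiver with labels in $X$, and $\le$ a monomial order on $\langle X\rangle$ such that each element of $F$ is $Q$-order compatible. Then each element of the output $G$ of the $Q$-order compatible completion procedure (described in the context) applied to $F$, $Q$ and $\le$ is both a $Q$-consequence of $F$ and $Q$-order compatible.
   Context: $\mathbb K\langle X\rangle$ is the free associative $\mathbb K$-algebra on $X$; $\langle X\rangle$ is the set of monomials, i.e. words over $X$ including the empty word $1$; $\operatorname{supp}(f)$ is the set of monomials with nonzero coefficient in $f$. A monomial order is a well-founded total order on $\langle X\rangle$ compatible with multiplication; $\operatorname{LM}(f)$ is the leading (largest) monomial of a nonzero polynomial $f$. A labelled quiver with labels in $X$ is $Q=(V,E,X,s,t,l)$ with $V$ a set of vertices, $E$ a set of edges, source and target maps $s,t:E\to V$ and a label function $l:E\to X$ (not necessarily injective). A nonempty path is $p=e_n\cdots e_1$ with $s(e_{i+1})=t(e_i)$; $s(p)=s(e_1)$, $t(p)=t(e_n)$, $l(p)=l(e_n)\cdots l(e_1)\in\langle X\rangle$. For each vertex $v$ there is an empty path $\epsilon_v$ from $v$ to $v$ with $l(\epsilon_v)=1$. Signatures: for a monomial $m$, $\sigma(m)=\{(s(p),t(p)) \mid p \text{ a path in } Q \text{ with } l(p)=m\}\subseteq V\times V$; for a polynomial $f$, $\sigma(f)=\bigcap_{m\in\operatorname{supp}(f)}\sigma(m)$ (so $\sigma(0)=V\times V$). $f$ is compatible with $Q$ if $\sigma(f)\neq\emptyset$.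 A compatible (nonzero) polynomial $f$ is $Q$-order compatible if $\sigma(\operatorname{LM}(f))=\sigma(f)$. A $Q$-consequence of $F\subseteq \mathbb K\langle X\rangle$ is a polynomial $f\in \mathbb K\langle X\rangle$, compatible with $Q$, such that there exist finitely many $g_i\in F$, $a_i,b_i\in \mathbb K\langle X\rangle$, $1\le i\le n$, with $f=\sum_{i=1}^n a_ig_ib_i$ (the empty sum being $0$) and such that for every $(u,v)\in\sigma(f)$ and every $i$ there exist vertices $u_i,v_i$ with $(u,u_i)\in\sigma(b_i)$, $(u_i,v_i)\in\sigma(g_i)$ and $(v_i,v)\in\sigma(a_i)$. Standard polynomial reduction: $f\to_G h$ if there are $g\in G$ and monomials $a,b$ with $a\operatorname{LM}(g)b\in\operatorname{supp}(f)$ and $h=f+\lambda agb$, where $\lambda\in\mathbb K$ is chosen such that the monomial $a\operatorname{LM}(g)b$ is cancelled in $h$. Ambiguities of a set $G$: $6$-tuples $\mathfrak a=(g,g',a,b,a',b')$ with $g,g'\in G$ and monomials $a,b,a',b'$ describing a minimal overlap or inclusion of the leading monomials, so that $a\operatorname{LM}(g)b=a'\operatorname{LM}(g')b'$. Overlap: $\operatorname{LM}(g)=AB$, $\operatorname{LM}(g')=BC$ with $A,B,C$ nonempty words, and $a=1$, $b=C$, $a'=A$, $b'=1$. Inclusion: $g\ne g'$, $\operatorname{LM}(g)=A\operatorname{LM}(g')C$ and $a=b=1$, $a'=A$, $b'=C$. The monomial $a\operatorname{LM}(g)b=a'\operatorname{LM}(g')b'$ is the source of $\mathfrak a$, and its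 $S$-polynomial is $\operatorname{SP}(\mathfrak a)=agb-a'g'b'$. $Q$-order compatible completion procedure. Input: $F$, $Q$, $\le$ such that every $f\in F$ is $Q$-order compatible. Initialize $P:=$ the ambiguities of $F$ and $G:=F$. While $P\ne\emptyset$: choose $\mathfrak a\in P$, remove it from $P$, put $s:=\operatorname{SP}(\mathfrak a)$ and let $m$ be the source of $\mathfrak a$. If $m$ is compatible with $Q$, $\sigma(s)\subseteq\sigma(m)$, and $s$ is $Q$-order compatible, then do the following (otherwise proceed to the next ambiguity): (i) while there exists $s'$ with $s\to_G s'$, take such an $s'$; if $s'=0$, discard $\mathfrak a$ and proceed to the next ambiguity without changing $G$; else if $\sigma(s')\subseteq\sigma(m)$ and $s'$ is $Q$-order compatible, set $s:=s'$ and continue this inner loop; else leave the inner loop keeping the current $s$; (ii) after leaving the inner loop, set $G:=G\cup\{s\}$ and add to $P$ the ambiguities created by $s$ (those of the new $G$ involving $s$). When $P=\emptyset$, return $G$. (All choices are arbitrary; the procedure is not guaranteed to terminate.) *)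

theory Defs
  imports "HOL-Library.Poly_Mapping" "Graph_Theory.Arc_Walk"
begin

text \<open>
  Words form a monoid under concatenation. It is written additively because the convolution
  product on \<^typ>\<open>'a \<Rightarrow>\<^sub>0 'b\<close> requires class \<^class>\<open>monoid_add\<close>.
\<close>

instantiation list :: (type) monoid_add
begin

definition zero_list :: "'a list" where
  "0 = []"

definition plus_list :: "'a list \<Rightarrow> 'a list \<Rightarrow> 'a list" where
  "xs + ys = xs @ ys"

instance
  by standard (simp_all add: zero_list_def plus_list_def)

end

type_synonym ('x, 'k) ncpoly = "'x list \<Rightarrow>\<^sub>0 'k"

definition free_algebra :: "'x set \<Rightarrow> ('x, 'k::field) ncpoly set" where
  "free_algebra X = {f. Poly_Mapping.keys f \<subseteq> lists X}"

abbreviation mon :: "'x list \<Rightarrow> ('x, 'k::field) ncpoly" where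
  "mon m \<equiv> Poly_Mapping.single m 1"

definition monomial_order :: "'x set \<Rightarrow> 'x list rel \<Rightarrow> bool" where
  "monomial_order X le \<longleftrightarrow> well_order_on (lists X) le \<and>
     (\<forall>(m, m') \<in> le. \<forall>a \<in> lists X. \<forall>b \<in> lists X. (a @ m @ b, a @ m' @ b) \<in> le)"

text \<open>Meaningful for nonzero polynomials only.\<close>

definition LM :: "'x list rel \<Rightarrow> ('x, 'k::field) ncpoly \<Rightarrow> 'x list" where
  "LM le f = (THE m. m \<in> Poly_Mapping.keys f \<and> (\<forall>m' \<in> Poly_Mapping.keys f. (m', m) \<in> le))"

locale labelled_quiver = wf_digraph Q
  for X :: "'x set" and Q :: "('v, 'e) pre_digraph" and l :: "'e \<Rightarrow> 'x" +
  assumes label_in: "e \<in> arcs Q \<Longrightarrow> l e \<in> X"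

text \<open>
  A walk lists its edges in the order of traversal \<open>e\<^sub>1, \<dots>, e\<^sub>n\<close>, whereas the label of the path
  is the word \<open>l e\<^sub>n \<dots> l e\<^sub>1\<close>; hence the reversal.
\<close>

definition path_label :: "('e \<Rightarrow> 'x) \<Rightarrow> 'e awalk \<Rightarrow> 'x list" where
  "path_label l p = rev (map l p)"

definition mon_signature ::
  "('v, 'e) pre_digraph \<Rightarrow> ('e \<Rightarrow> 'x) \<Rightarrow> 'x list \<Rightarrow> ('v \<times> 'v) set" where
  "mon_signature Q l m = {(u, v). \<exists>p. pre_digraph.awalk Q u p v \<and> path_label l p = m}"

text \<open>
  Intersecting with \<open>verts Q \<times> verts Q\<close> only matters for \<open>f = 0\<close>, where the intersection over the
  empty support has to be taken inside \<open>V \<times> V\<close>.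
\<close>

definition signature ::
  "('v, 'e) pre_digraph \<Rightarrow> ('e \<Rightarrow> 'x) \<Rightarrow> ('x, 'k::field) ncpoly \<Rightarrow> ('v \<times> 'v) set" where
  "signature Q l f = (verts Q \<times> verts Q) \<inter> (\<Inter>m \<in> Poly_Mapping.keys f. mon_signature Q l m)"

definition mon_compatible :: "('v, 'e) pre_digraph \<Rightarrow> ('e \<Rightarrow> 'x) \<Rightarrow> 'x list \<Rightarrow> bool" where
  "mon_compatible Q l m \<longleftrightarrow> mon_signature Q l m \<noteq> {}"

definition compatible :: "('v, 'e) pre_digraph \<Rightarrow> ('e \<Rightarrow> 'x) \<Rightarrow> ('x, 'k::field) ncpoly \<Rightarrow> bool" where
  "compatible Q l f \<longleftrightarrow> signature Q l f \<noteq> {}"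

definition order_compatible ::
  "('v, 'e) pre_digraph \<Rightarrow> ('e \<Rightarrow> 'x) \<Rightarrow> 'x list rel \<Rightarrow> ('x, 'k::field) ncpoly \<Rightarrow> bool" where
  "order_compatible Q l le f \<longleftrightarrow>
     f \<noteq> 0 \<and> compatible Q l f \<and> mon_signature Q l (LM le f) = signature Q l f"

definition Q_consequence ::
  "'x set \<Rightarrow> ('v, 'e) pre_digraph \<Rightarrow> ('e \<Rightarrow> 'x) \<Rightarrow> ('x, 'k::field) ncpoly set
    \<Rightarrow> ('x, 'k) ncpoly \<Rightarrow> bool" where
  "Q_consequence X Q l F f \<longleftrightarrow>
     f \<in> free_algebra X \<and> compatible Q l f \<and>
     (\<exists>(n::nat) a g b.
        (\<forall>i \<in> {1..n}. a i \<in> free_algebra X \<and> g i \<in> F \<and> b i \<in> free_algebra X) \<and>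
        f = (\<Sum>i = 1..n. a i * g i * b i) \<and>
        (\<forall>(u, v) \<in> signature Q l f. \<forall>i \<in> {1..n}. \<exists>u' v'.
           (u, u') \<in> signature Q l (b i) \<and> (u', v') \<in> signature Q l (g i) \<and>
           (v', v) \<in> signature Q l (a i)))"

text \<open>
  Below, words occurring as factors need not be restricted to letters in \<open>X\<close>: they are
  factors of a word in the support of \<open>f\<close>, or of a leading monomial of an element of \<open>G\<close>.
\<close>

definition reduces ::
  "'x list rel \<Rightarrow> ('x, 'k::field) ncpoly set \<Rightarrow> ('x, 'k) ncpoly \<Rightarrow> ('x, 'k) ncpoly \<Rightarrow> bool" where
  "reduces le G f h \<longleftrightarrow>
     (\<exists>g \<in> G. \<exists>a b c. g \<noteq> 0 \<and> a @ LM le g @ b \<in> Poly_Mapping.keys f \<and>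
        h = f + Poly_Mapping.single [] c * (mon a * g * mon b) \<and>
        a @ LM le g @ b \<notin> Poly_Mapping.keys h)"

type_synonym ('x, 'k) ambiguity =
  "('x, 'k) ncpoly \<times> ('x, 'k) ncpoly \<times> 'x list \<times> 'x list \<times> 'x list \<times> 'x list"

definition overlaps ::
  "'x list rel \<Rightarrow> ('x, 'k::field) ncpoly set \<Rightarrow> ('x, 'k) ambiguity set" where
  "overlaps le G = {(g, g', [], C, A, []) | g g' A C.
     g \<in> G \<and> g' \<in> G \<and>
     (\<exists>B. A \<noteq> [] \<and> B \<noteq> [] \<and> C \<noteq> [] \<and> LM le g = A @ B \<and> LM le g' = B @ C)}"

definition inclusions ::
  "'x list rel \<Rightarrow> ('x, 'k::field) ncpoly set \<Rightarrow> ('x, 'k) ambiguity set" where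
  "inclusions le G = {(g, g', [], [], A, C) | g g' A C.
     g \<in> G \<and> g' \<in> G \<and> g \<noteq> g' \<and> LM le g = A @ LM le g' @ C}"

definition ambiguities ::
  "'x list rel \<Rightarrow> ('x, 'k::field) ncpoly set \<Rightarrow> ('x, 'k) ambiguity set" where
  "ambiguities le G = overlaps le G \<union> inclusions le G"

definition ambiguities_involving ::
  "'x list rel \<Rightarrow> ('x, 'k::field) ncpoly set \<Rightarrow> ('x, 'k) ncpoly \<Rightarrow> ('x, 'k) ambiguity set" where
  "ambiguities_involving le G s =
     {(g, g', a, b, a', b') \<in> ambiguities le G. g = s \<or> g' = s}"

fun source :: "'x list rel \<Rightarrow> ('x, 'k::field) ambiguity \<Rightarrow> 'x list" where
  "source le (g, g', a, b, a', b') = a @ LM le g @ b"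

fun SP :: "('x, 'k::field) ambiguity \<Rightarrow> ('x, 'k) ncpoly" where
  "SP (g, g', a, b, a', b') = mon a * g * mon b - mon a' * g' * mon b'"

text \<open>
  \<open>admissible Q l le m s\<close> is the test applied both to the S-polynomial and to each of its
  reducts. In \<open>inner_loop\<close>, the result \<open>None\<close> means that the ambiguity is discarded, and \<open>Some s\<close>
  that the loop is left with \<open>s\<close>, which is then added to \<open>G\<close>. All choices are nondeterministic.
\<close>

definition admissible ::
  "('v, 'e) pre_digraph \<Rightarrow> ('e \<Rightarrow> 'x) \<Rightarrow> 'x list rel \<Rightarrow> 'x list \<Rightarrow> ('x, 'k::field) ncpoly \<Rightarrow> bool" where
  "admissible Q l le m s \<longleftrightarrow>
     signature Q l s \<subseteq> mon_signature Q l m \<and> order_compatible Q l le s"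

inductive inner_loop ::
  "('v, 'e) pre_digraph \<Rightarrow> ('e \<Rightarrow> 'x) \<Rightarrow> 'x list rel \<Rightarrow> ('x, 'k::field) ncpoly set \<Rightarrow> 'x list
    \<Rightarrow> ('x, 'k) ncpoly \<Rightarrow> ('x, 'k) ncpoly option \<Rightarrow> bool"
  for Q l le G m where
  irreducible: "\<nexists>s'. reduces le G s s' \<Longrightarrow> inner_loop Q l le G m s (Some s)"
| zero: "reduces le G s 0 \<Longrightarrow> inner_loop Q l le G m s None"
| continue: "reduces le G s s' \<Longrightarrow> s' \<noteq> 0 \<Longrightarrow> admissible Q l le m s' \<Longrightarrow>
    inner_loop Q l le G m s' r \<Longrightarrow> inner_loop Q l le G m s r"
| leave: "reduces le G s s' \<Longrightarrow> s' \<noteq> 0 \<Longrightarrow> \<not> admissible Q l le m s' \<Longrightarrow>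
    inner_loop Q l le G m s (Some s)"

text \<open>One iteration of the outer loop, on states \<open>(G, P)\<close>.\<close>

inductive completion_step ::
  "('v, 'e) pre_digraph \<Rightarrow> ('e \<Rightarrow> 'x) \<Rightarrow> 'x list rel
    \<Rightarrow> ('x, 'k::field) ncpoly set \<times> ('x, 'k) ambiguity set
    \<Rightarrow> ('x, 'k) ncpoly set \<times> ('x, 'k) ambiguity set \<Rightarrow> bool"
  for Q l le where
  skip: "\<aa> \<in> P \<Longrightarrow>
    \<not> (mon_compatible Q l (source le \<aa>) \<and> admissible Q l le (source le \<aa>) (SP \<aa>)) \<Longrightarrow>
    completion_step Q l le (G, P) (G, P - {\<aa>})"
| discard: "\<aa> \<in> P \<Longrightarrow>
    mon_compatible Q l (source le \<aa>) \<Longrightarrow> admissible Q l le (source le \<aa>) (SP \<aa>) \<Longrightarrow>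
    inner_loop Q l le G (source le \<aa>) (SP \<aa>) None \<Longrightarrow>
    completion_step Q l le (G, P) (G, P - {\<aa>})"
| extend: "\<aa> \<in> P \<Longrightarrow>
    mon_compatible Q l (source le \<aa>) \<Longrightarrow> admissible Q l le (source le \<aa>) (SP \<aa>) \<Longrightarrow>
    inner_loop Q l le G (source le \<aa>) (SP \<aa>) (Some s) \<Longrightarrow>
    completion_step Q l le (G, P)
      (insert s G, (P - {\<aa>}) \<union> ambiguities_involving le (insert s G) s)"

definition completion_output ::
  "('v, 'e) pre_digraph \<Rightarrow> ('e \<Rightarrow> 'x) \<Rightarrow> 'x list rel \<Rightarrow> ('x, 'k::field) ncpoly set
    \<Rightarrow> ('x, 'k) ncpoly set \<Rightarrow> bool" where
  "completion_output Q l le F G \<longleftrightarrow>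
     (completion_step Q l le)\<^sup>*\<^sup>* (F, ambiguities le F) (G, {})"

end

theory Submission
  imports Defs
begin

text \<open>
  Let \<open>m\<close> be the source of an ambiguity of \<open>g\<close> and \<open>g'\<close>. A path labelled by
  \<open>m = a LM(g) b\<close> splits into paths labelled by \<open>b\<close>, \<open>LM(g)\<close> and \<open>a\<close>, and as \<open>g\<close> is order
  compatible, the middle part can be replaced by a path for any other monomial of \<open>g\<close>. So all of
  \<open>\<sigma>(m)\<close> is carried by the cofactor representation of the S-polynomial, and in particular by
  each of its monomials. Reduction preserves this: the monomial \<open>a LM(g) b\<close> being cancelled
  occurs in the current polynomial, hence its signature contains \<open>\<sigma>(m)\<close>, and the same
  argument applies to the subtracted multiple of \<open>g\<close>. When the inner loop ends, admissibility
  gives \<open>\<sigma>(s) \<subseteq> \<sigma>(m)\<close>, so the representation of \<open>s\<close> is one of a \<open>Q\<close>-consequence.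
\<close>

section \<open>Words and products in the free algebra\<close>

lemma keys_mult_append:
  fixes f g :: "('x, 'k::field) ncpoly"
  assumes "w \<in> Poly_Mapping.keys (f * g)"
  obtains p q where "p \<in> Poly_Mapping.keys f" "q \<in> Poly_Mapping.keys g" "w = p @ q"
  using assms keys_mult[of f g] unfolding plus_list_def by blast

lemma single_mult_single:
  "Poly_Mapping.single p c * Poly_Mapping.single q d = Poly_Mapping.single (p @ q) (c * d :: 'k::field)"
  by (simp add: mult_single plus_list_def)

lemma single_Nil_one: "Poly_Mapping.single [] (1::'k::field) = 1"
  unfolding zero_list_def[symmetric] by simp

lemma single_in_free_algebra: "p \<in> lists X \<Longrightarrow> Poly_Mapping.single p c \<in> free_algebra X"
  by (auto simp: free_algebra_def split: if_splits)

lemma free_algebra_add: "f \<in> free_algebra X \<Longrightarrow> g \<in> free_algebra X \<Longrightarrow> f + g \<in> free_algebra X"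
  using Poly_Mapping.keys_add[of f g] by (auto simp: free_algebra_def)

lemma free_algebra_mult: "f \<in> free_algebra X \<Longrightarrow> g \<in> free_algebra X \<Longrightarrow> f * g \<in> free_algebra X"
  unfolding free_algebra_def
  by (intro CollectI subsetI, elim keys_mult_append) (simp add: subset_iff)

section \<open>Signatures, and representations carried by a set of vertex pairs\<close>

context labelled_quiver
begin

lemma mon_signature_subset_verts: "mon_signature Q l w \<subseteq> verts Q \<times> verts Q"
  unfolding mon_signature_def by auto

text \<open>Labels are read against the direction of travel, so a path for \<open>p @ q\<close>
  walks \<open>q\<close> first. Since \<open>O\<close> composes from left to right, the factors
  trade places; all later products of signatures inherit this order.\<close>

lemma mon_signature_append: "mon_signature Q l (p @ q) = mon_signature Q l q O mon_signature Q l p"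
proof (intro equalityI subrelI)
  fix u v assume "(u, v) \<in> mon_signature Q l (p @ q)"
  then obtain w where w: "awalk u w v" "rev (map l w) = p @ q"
    unfolding mon_signature_def path_label_def by auto
  from arg_cong[OF w(2), of rev] have "map l w = rev q @ rev p"
    by simp
  then obtain w1 w2 where w12: "w = w1 @ w2" "rev q = map l w1" "rev p = map l w2"
    by (auto simp: map_eq_append_conv)
  with w(1) obtain x where "awalk u w1 x" "awalk x w2 v"
    by auto
  moreover have "path_label l w1 = q" "path_label l w2 = p"
    by (simp_all add: path_label_def flip: w12(2,3))
  ultimately show "(u, v) \<in> mon_signature Q l q O mon_signature Q l p"
    unfolding mon_signature_def by blast
next
  fix u v assume "(u, v) \<in> mon_signature Q l q O mon_signature Q l p"
  then obtain x w1 w2 where "awalk u w1 x" "awalk x w2 v" "path_label l w1 = q" "path_label l w2 = p"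
    unfolding mon_signature_def by auto
  then show "(u, v) \<in> mon_signature Q l (p @ q)"
    unfolding mon_signature_def path_label_def
    using awalk_appendI by (fastforce intro!: exI[of _ "w1 @ w2"])
qed

lemma mon_signature_Nil: "mon_signature Q l [] = Id_on (verts Q)"
  unfolding mon_signature_def path_label_def by (auto simp: awalk_def)

text \<open>Edge labels lie in \<open>X\<close>. This puts the cofactors of an ambiguity into
  \<open>free_algebra X\<close>, although \<open>ambiguities\<close> does not restrict the
  letters.\<close>

lemma mon_compatible_in_lists: "mon_compatible Q l w \<Longrightarrow> w \<in> lists X"
  unfolding mon_compatible_def mon_signature_def path_label_def
  by (auto intro!: label_in simp: awalk_def)

lemma signature_subset_mon: "w \<in> Poly_Mapping.keys f \<Longrightarrow> signature Q l f \<subseteq> mon_signature Q l w"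
  unfolding signature_def by blast

text \<open>Equality can fail for \<open>c = 0\<close>, where the right-hand side is all of
  \<open>verts Q \<times> verts Q\<close>.\<close>

lemma mon_signature_subset_single: "mon_signature Q l w \<subseteq> signature Q l (Poly_Mapping.single w c)"
  using mon_signature_subset_verts by (auto simp: signature_def)

lemma signature_add: "signature Q l f \<inter> signature Q l g \<subseteq> signature Q l (f + g)"
  using Poly_Mapping.keys_add[of f g] unfolding signature_def by blast

lemma signature_mult: "signature Q l g O signature Q l f \<subseteq> signature Q l (f * g)"
proof (rule subrelI)
  fix u v assume "(u, v) \<in> signature Q l g O signature Q l f"
  then obtain x where x: "(u, x) \<in> signature Q l g" "(x, v) \<in> signature Q l f"
    by blast
  have "(u, v) \<in> mon_signature Q l w" if "w \<in> Poly_Mapping.keys (f * g)" for w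
    using that x by (elim keys_mult_append) (auto simp: mon_signature_append signature_def)
  with x show "(u, v) \<in> signature Q l (f * g)"
    unfolding signature_def by auto
qed

text \<open>The set \<open>R\<close> is kept apart from the signature of the polynomial: along a
  chain of reductions that signature may change, while \<open>R\<close> stays \<sigma>(m) for the
  source m of the ambiguity. For \<open>R\<close> equal to the signature this becomes the path
  condition of a \<open>Q_consequence\<close>.\<close>

inductive represented for F :: "('x, 'k::field) ncpoly set" and R :: "('v \<times> 'v) set" where
  represented_0: "represented F R 0"
| represented_add_term: "represented F R f \<Longrightarrow> a \<in> free_algebra X \<Longrightarrow> g \<in> F \<Longrightarrow> b \<in> free_algebra X \<Longrightarrow>
    R \<subseteq> signature Q l b O signature Q l g O signature Q l a \<Longrightarrow>
    represented F R (f + a * g * b)"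

text \<open>The induction runs over \<open>f'\<close>, whose terms are appended to \<open>f\<close>
  one at a time.\<close>

lemma represented_add:
  "represented F R f' \<Longrightarrow> represented F R f \<Longrightarrow> represented F R (f + f')"
  by (induction rule: represented.induct)
    (auto simp: add.assoc[symmetric] intro: represented_add_term)

text \<open>Multiplying every term by \<open>p\<close> and \<open>q\<close> extends its paths at
  both ends. This lets an element of the current basis be replaced by its representation over
  \<open>F\<close>.\<close>

lemma represented_mult:
  assumes "represented F S f" "p \<in> free_algebra X" "q \<in> free_algebra X"
    and R: "R \<subseteq> signature Q l q O S O signature Q l p"
  shows "represented F R (p * f * q)"
  using assms(1)
proof (induction rule: represented.induct)
  case represented_0
  show ?case by (simp add: represented.represented_0)
next
  case (represented_add_term f a g b)
  have "R \<subseteq> (signature Q l q O signature Q l b) O signature Q l g O (signature Q l a O signature Q l p)"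
    using R represented_add_term.hyps by fast
  also have "\<dots> \<subseteq> signature Q l (b * q) O signature Q l g O signature Q l (p * a)"
    by (intro relcomp_mono signature_mult order.refl)
  finally have "represented F R (p * f * q + (p * a) * g * (b * q))"
    using represented_add_term assms(2,3)
    by (intro represented.represented_add_term free_algebra_mult) auto
  then show ?case
    by (simp add: algebra_simps)
qed

lemma represented_in_free_algebra:
  assumes "represented F R f" "F \<subseteq> free_algebra X"
  shows "f \<in> free_algebra X"
  using assms(1)
proof (induction rule: represented.induct)
  case represented_0
  show ?case by (simp add: free_algebra_def)
next
  case (represented_add_term f a g b)
  then show ?case
    using assms(2) by (blast intro: free_algebra_add free_algebra_mult)
qed

text \<open>Each term has a signature containing \<open>R\<close>, and cancellation in the sum only
  removes monomials, which can only enlarge the signature. The bound on \<open>R\<close> covers the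
  empty sum.\<close>

lemma represented_subset_signature:
  assumes "represented F R f" "R \<subseteq> verts Q \<times> verts Q"
  shows "R \<subseteq> signature Q l f"
  using assms(1)
proof (induction rule: represented.induct)
  case represented_0
  show ?case using assms(2) by (simp add: signature_def)
next
  case (represented_add_term f a g b)
  have "signature Q l b O signature Q l g O signature Q l a \<subseteq> signature Q l (a * g * b)"
    using signature_mult[of b "a * g"] signature_mult[of g a] by blast
  then show ?case
    using represented_add_term signature_add[of f "a * g * b"] by blast
qed

lemma represented_imp_sum:
  assumes "represented F R f"
  shows "\<exists>(n::nat) a g b.
    (\<forall>i \<in> {1..n}. a i \<in> free_algebra X \<and> g i \<in> F \<and> b i \<in> free_algebra X) \<and>
    f = (\<Sum>i = 1..n. a i * g i * b i) \<and>
    (\<forall>i \<in> {1..n}. R \<subseteq> signature Q l (b i) O signature Q l (g i) O signature Q l (a i))"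
  using assms
proof (induction rule: represented.induct)
  case represented_0
  show ?case by (rule exI[of _ 0]) simp
next
  case (represented_add_term f a' g' b')
  then obtain n :: nat and a g b where *:
    "\<forall>i \<in> {1..n}. a i \<in> free_algebra X \<and> g i \<in> F \<and> b i \<in> free_algebra X"
    "f = (\<Sum>i = 1..n. a i * g i * b i)"
    "\<forall>i \<in> {1..n}. R \<subseteq> signature Q l (b i) O signature Q l (g i) O signature Q l (a i)"
    by blast
  \<comment> \<open>The new term goes to index \<open>Suc n\<close>, leaving the first
    \<open>n\<close> terms unchanged.\<close>
  define A where "A = a(Suc n := a')"
  define C where "C = g(Suc n := g')"
  define B where "B = b(Suc n := b')"
  have "(\<Sum>i = 1..n. A i * C i * B i) = (\<Sum>i = 1..n. a i * g i * b i)"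
    by (intro sum.cong) (auto simp: A_def B_def C_def)
  then have "f + a' * g' * b' = (\<Sum>i = 1..Suc n. A i * C i * B i)"
    using *(2) by (simp add: A_def B_def C_def)
  moreover have "\<forall>i \<in> {1..Suc n}. A i \<in> free_algebra X \<and> C i \<in> F \<and> B i \<in> free_algebra X"
    using *(1) represented_add_term.hyps by (auto simp: A_def B_def C_def)
  moreover have "\<forall>i \<in> {1..Suc n}. R \<subseteq> signature Q l (B i) O signature Q l (C i) O signature Q l (A i)"
    using *(3) represented_add_term.hyps by (auto simp: A_def B_def C_def)
  ultimately show ?case by blast
qed

lemma represented_imp_Q_consequence:
  assumes "represented F (signature Q l f) f" "F \<subseteq> free_algebra X" "compatible Q l f"
  shows "Q_consequence X Q l F f"
proof -
  from represented_imp_sum[OF assms(1)] obtain n :: nat and a g b where *: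
    "\<forall>i \<in> {1..n}. a i \<in> free_algebra X \<and> g i \<in> F \<and> b i \<in> free_algebra X"
    "f = (\<Sum>i = 1..n. a i * g i * b i)"
    "\<forall>i \<in> {1..n}. signature Q l f \<subseteq> signature Q l (b i) O signature Q l (g i) O signature Q l (a i)"
    by blast
  have "\<forall>(u, v) \<in> signature Q l f. \<forall>i \<in> {1..n}. \<exists>u' v'.
      (u, u') \<in> signature Q l (b i) \<and> (u', v') \<in> signature Q l (g i) \<and> (v', v) \<in> signature Q l (a i)"
    using *(3) by fast
  with * represented_in_free_algebra[OF assms(1,2)] assms(3) show ?thesis
    unfolding Q_consequence_def by blast
qed

section \<open>Representations of generators, reducts and S-polynomials\<close>

lemma represented_generator:
  fixes F :: "('x, 'k::field) ncpoly set"
  assumes "f \<in> F"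
  shows "represented F (signature Q l f) f"
proof -
  have "Id_on (verts Q) \<subseteq> signature Q l (1 :: ('x, 'k) ncpoly)"
    using mon_signature_subset_single[of "[]" 1] by (simp add: single_Nil_one mon_signature_Nil)
  \<comment> \<open>Both cofactors are 1, realised by the empty paths at the two ends.\<close>
  moreover have "signature Q l f \<subseteq> Id_on (verts Q) O signature Q l f O Id_on (verts Q)"
    by (auto simp: signature_def)
  ultimately have "signature Q l f \<subseteq> signature Q l (1 :: ('x, 'k) ncpoly) O signature Q l f O signature Q l (1 :: ('x, 'k) ncpoly)"
    by blast
  moreover have "(1 :: ('x, 'k) ncpoly) \<in> free_algebra X"
    using single_in_free_algebra[of "[]" X "1::'k"] by (simp add: single_Nil_one)
  ultimately have "represented F (signature Q l f) (0 + 1 * f * 1)"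
    using assms by (intro represented.intros)
  then show ?thesis by simp
qed

text \<open>Order compatibility turns the middle factor \<sigma>(LM(g)) of \<sigma>(a LM(g) b) into
  \<sigma>(g), where the representation of \<open>g\<close> over \<open>F\<close> applies.\<close>

lemma represented_LM_multiple:
  fixes F :: "('x, 'k::field) ncpoly set"
  assumes "represented F (signature Q l g) g" "order_compatible Q l le g"
    and "a @ LM le g @ b \<in> lists X" "R \<subseteq> mon_signature Q l (a @ LM le g @ b)"
  shows "represented F R (Poly_Mapping.single a c * g * mon b)"
proof (rule represented_mult[OF assms(1)])
  have "R \<subseteq> mon_signature Q l b O signature Q l g O mon_signature Q l a"
    using assms(2,4) by (auto simp: mon_signature_append order_compatible_def O_assoc)
  also have "\<dots> \<subseteq> signature Q l (mon b :: ('x, 'k) ncpoly) O signature Q l g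
      O signature Q l (Poly_Mapping.single a c)"
    by (intro relcomp_mono mon_signature_subset_single order.refl)
  finally show "R \<subseteq> signature Q l (mon b :: ('x, 'k) ncpoly) O signature Q l g
      O signature Q l (Poly_Mapping.single a c)" .
qed (use assms(3) in \<open>auto intro!: single_in_free_algebra\<close>)

text \<open>The loop invariant on the basis; it still refers to the original \<open>F\<close>, so
  that consequences need not be composed afterwards.\<close>

definition good_basis :: "'x list rel \<Rightarrow> ('x, 'k::field) ncpoly set \<Rightarrow> ('x, 'k) ncpoly set \<Rightarrow> bool" where
  "good_basis le F G \<longleftrightarrow> (\<forall>g \<in> G. represented F (signature Q l g) g \<and> order_compatible Q l le g)"

lemma represented_reduct:
  assumes "F \<subseteq> free_algebra X" "good_basis le F G" "R \<subseteq> verts Q \<times> verts Q"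
    and s: "represented F R s" and "reduces le G s s'"
  shows "represented F R s'"
proof -
  from assms(5) obtain g a b c where g: "g \<in> G" and w: "a @ LM le g @ b \<in> Poly_Mapping.keys s"
    and s': "s' = s + Poly_Mapping.single [] c * (mon a * g * mon b)"
    unfolding reduces_def by blast
  have "R \<subseteq> mon_signature Q l (a @ LM le g @ b)"
    using represented_subset_signature[OF s assms(3)] signature_subset_mon[OF w] by blast
  moreover have "a @ LM le g @ b \<in> lists X"
    using represented_in_free_algebra[OF s assms(1)] w by (auto simp: free_algebra_def)
  ultimately have "represented F R (Poly_Mapping.single a c * g * mon b)"
    using g assms(2) by (intro represented_LM_multiple) (auto simp: good_basis_def)
  \<comment> \<open>The scalar is absorbed into the left cofactor.\<close>
  moreover have "s' = s + Poly_Mapping.single a c * g * mon b"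
    unfolding s' by (simp add: mult.assoc[symmetric] single_mult_single)
  ultimately show ?thesis
    using represented_add s by blast
qed

text \<open>Only an admissible reduct becomes the current polynomial; on \<open>leave\<close> the
  failing reduct is dropped and its predecessor, which passed the test, is returned.\<close>

lemma inner_loop_result:
  assumes "inner_loop Q l le G m s r" "F \<subseteq> free_algebra X" "good_basis le F G"
    and "represented F (mon_signature Q l m) s" "admissible Q l le m s" "r = Some s'"
  shows "represented F (mon_signature Q l m) s' \<and> admissible Q l le m s'"
  using assms(1,4-)
proof (induction rule: inner_loop.induct)
  case (continue s s\<^sub>1 r)
  then show ?case
    using represented_reduct[OF assms(2,3) mon_signature_subset_verts] by blast
qed auto

lemma represented_SP:
  fixes F :: "('x, 'k::field) ncpoly set"
  assumes "good_basis le F G" "g \<in> G" "g' \<in> G"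
    and "a @ LM le g @ b = a' @ LM le g' @ b'" "mon_compatible Q l (a @ LM le g @ b)"
  shows "represented F (mon_signature Q l (a @ LM le g @ b)) (SP (g, g', a, b, a', b'))"
proof -
  let ?R = "mon_signature Q l (a @ LM le g @ b)"
  have lists: "a @ LM le g @ b \<in> lists X"
    using assms(5) by (rule mon_compatible_in_lists)
  have "represented F ?R (mon a * g * mon b)"
    using assms(1,2) lists by (intro represented_LM_multiple) (auto simp: good_basis_def)
  moreover have "represented F ?R (Poly_Mapping.single a' (-1) * g' * mon b')"
    using assms(1,3) lists unfolding assms(4)
    by (intro represented_LM_multiple) (auto simp: good_basis_def)
  ultimately have "represented F ?R (mon a * g * mon b + Poly_Mapping.single a' (-1) * g' * mon b')"
    by (rule represented_add[rotated])
  moreover have "Poly_Mapping.single a' (-1) = - (mon a' :: ('x, 'k) ncpoly)"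
    by (rule single_uminus)
  ultimately show ?thesis
    by simp
qed

section \<open>The invariant of the completion procedure\<close>

lemma ambiguities_source:
  assumes "(g, g', a, b, a', b') \<in> ambiguities le G"
  shows "g \<in> G" "g' \<in> G" "a @ LM le g @ b = a' @ LM le g' @ b'"
  using assms unfolding ambiguities_def overlaps_def inclusions_def by auto

lemma ambiguities_mono: "G \<subseteq> H \<Longrightarrow> ambiguities le G \<subseteq> ambiguities le H"
  unfolding ambiguities_def overlaps_def inclusions_def by auto

lemma completion_step_invariant:
  assumes "completion_step Q l le (G, P) (G', P')" "F \<subseteq> free_algebra X"
    and "good_basis le F G" "P \<subseteq> ambiguities le G"
  shows "good_basis le F G' \<and> P' \<subseteq> ambiguities le G'"
  using assms(1)
proof cases
  case (extend \<aa> s)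
  obtain g g' a b a' b' where \<aa>: "\<aa> = (g, g', a, b, a', b')"
    by (cases \<aa>)
  let ?m = "source le \<aa>"
  have "(g, g', a, b, a', b') \<in> ambiguities le G"
    using extend(3) assms(4) \<aa> by auto
  note src = ambiguities_source[OF this]
  have "represented F (mon_signature Q l ?m) (SP \<aa>)"
    using represented_SP[OF assms(3) src] extend(4) unfolding \<aa> source.simps .
  then have s: "represented F (mon_signature Q l ?m) s" "admissible Q l le ?m s"
    using inner_loop_result[OF extend(6) assms(2,3)] extend(5) by auto
  \<comment> \<open>The representation gives one inclusion and admissibility the other, so
    \<sigma>(m) can be exchanged for \<sigma>(s), as \<open>good_basis\<close> demands.\<close>
  then have "signature Q l s = mon_signature Q l ?m" "order_compatible Q l le s"
    using represented_subset_signature[OF _ mon_signature_subset_verts]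
    unfolding admissible_def by blast+
  with s have "good_basis le F (insert s G)"
    using assms(3) by (simp add: good_basis_def)
  moreover have "P' \<subseteq> ambiguities le (insert s G)"
    using extend(2) assms(4) ambiguities_mono[of G "insert s G" le]
    unfolding ambiguities_involving_def by blast
  ultimately show ?thesis
    using extend by simp
qed (use assms in auto)

lemma completion_output_good_basis:
  assumes "F \<subseteq> free_algebra X" "\<forall>f \<in> F. order_compatible Q l le f" "completion_output Q l le F G"
  shows "good_basis le F G"
proof -
  have "good_basis le F (fst st) \<and> snd st \<subseteq> ambiguities le (fst st)"
    if "(completion_step Q l le)\<^sup>*\<^sup>* (F, ambiguities le F) st" for st
    using that
  proof (induction rule: rtranclp_induct)
    case base
    show ?case using assms(2) by (auto simp: good_basis_def represented_generator)
  next
    case (step y z)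
    then show ?case
      using completion_step_invariant[of le "fst y" "snd y" "fst z" "snd z" F] assms(1) by simp
  qed
  from this[of "(G, {})"] show ?thesis
    using assms(3) by (simp add: completion_output_def)
qed

end

theorem theorem4:
  fixes X :: "'x set"
    and F G :: "('x, 'k::field) ncpoly set"
    and Q :: "('v, 'e) pre_digraph"
    and l :: "'e \<Rightarrow> 'x"
    and le :: "'x list rel"
  assumes "F \<subseteq> free_algebra X"
    and "labelled_quiver X Q l"
    and "monomial_order X le"
    and "\<forall>f \<in> F. order_compatible Q l le f"
    and "completion_output Q l le F G"
  shows "\<forall>g \<in> G. Q_consequence X Q l F g \<and> order_compatible Q l le g"
proof -
  interpret labelled_quiver X Q l by fact
  have "good_basis le F G"
    using assms by (intro completion_output_good_basis)
  then show ?thesis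
    using represented_imp_Q_consequence[OF _ assms(1)]
    by (auto simp: good_basis_def order_compatible_def)
qed

end
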